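(* Let $N\ge 1$ be an even integer and $h=\sqrt{2}\,N^{-1/2}$ (so $N=2/h^2$). Then for all integers $0\le n,m\le N$: $$H_h\varphi_{n,h}=(2n+1)\varphi_{n,h},\qquad \langle \varphi_{n,h},\varphi_{m,h}\rangle_{\ell^2(h\mathbb{Z})}=\delta_{n,m},$$ $$L_{n,h}\varphi_{n,h}=\sqrt{n(2-nh^2+h^2)}\;\varphi_{n-1,h},\qquad R_{n,h}\varphi_{n,h}=\sqrt{(2-nh^2)(n+1)}\;\varphi_{n+1,h},$$ and moreover, for all $u,v\in\ell^2(h\mathbb{Z})$, $$\langle R_{n,h}u,v\rangle_{\ell^2(h\mathbb{Z})}=\langle u,L_{n,h}v\rangle_{\ell^2(h\mathbb{Z})},$$ and, for all $u\in\ell^2(h\mathbb{Z})$ and all $a\in A_h$, $$\tfrac12\big(R_{n-1,h}L_{n,h}+L_{n+1,h}R_{n,h}\big)u(a)=(1-ah-nh^2)\,H_hu(a)+\big((2n+1)ah+(n+1)nh^2\big)u(a).$$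
   Context: $\ell^2(h\mathbb{Z})$ is the space of $u:h\mathbb{Z}\to\mathbb{C}$ with $h\sum_{a\in h\mathbb{Z}}|u(a)|^2<\infty$, with scalar product $\langle u,v\rangle_{\ell^2(h\mathbb{Z})}=h\sum_{a\in h\mathbb{Z}}u(a)\overline{v(a)}$. Set $A_h=h\mathbb{Z}\cap[-1/h,1/h]$. Scaled Kravchuk polynomials: $k_{0,h}=1$, $k_{n,h}=0$ for $n<0$, and $k_{n+1,h}(x)=2x\,k_{n,h}(x)-2n\left(1-h^2\frac{n-1}{2}\right)k_{n-1,h}(x)$ for $n\ge0$. Kravchuk functions: for $0\le n\le N$ and $a\in h\mathbb{Z}$, $\varphi_{n,h}(a)=\alpha_{n,h}\,k_{n,h}(a)\sqrt{\rho_h(a)}$, where $\alpha_{n,h}=\frac{1}{h^n}\sqrt{\frac{(N-n)!}{N!\,n!}}$, $\rho_h(a)=\frac{1}{h2^N}\binom{N}{k}$ with $k=\frac1{h^2}+\frac ah$ for $a\in A_h$, and $\rho_h(a)=0$ for $a\notin A_h$. By convention $\varphi_{-1,h}=\varphi_{N+1,h}=0$. Operators: for $u\in\ell^2(h\mathbb{Z})$, $n\in\mathbb{Z}$ and $a\in A_h$, $$H_hu(a)=-\tfrac1{h^2}\sqrt{(1+ah+h^2)(1-ah)}\,u(a+h)-\tfrac1{h^2}\sqrt{(1-ah+h^2)(1+ah)}\,u(a-h)+\left(1+\tfrac2{h^2}\right)u(a),$$ $$L_{n,h}u(a)=\left(nh-\tfrac1h+a\right)u(a)+\tfrac1h\sqrt{(1-ah)(1+ah+h^2)}\,u(a+h),$$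 $$R_{n,h}u(a)=\left(nh-\tfrac1h+a\right)u(a)+\tfrac1h\sqrt{(1+ah)(1-ah+h^2)}\,u(a-h),$$ and $H_hu(a)=L_{n,h}u(a)=R_{n,h}u(a)=0$ for $a\in h\mathbb{Z}\setminus A_h$. *)

theory Defs
  imports Complex_Main "HOL-Analysis.Infinite_Sum" "HOL-Computational_Algebra.Polynomial"
begin

text \<open>
  A function on the lattice \<open>h\<int>\<close> is represented by a function \<open>real \<Rightarrow> complex\<close> of which
  only the values on \<open>grid h\<close> matter; identities between such functions are stated pointwise
  on \<open>grid h\<close>.
\<close>

definition grid :: "real \<Rightarrow> real set" where
  "grid h = range (\<lambda>j::int. h * of_int j)"

definition A_set :: "real \<Rightarrow> real set" where
  "A_set h = grid h \<inter> {- 1 / h .. 1 / h}"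

definition ell2 :: "real \<Rightarrow> (real \<Rightarrow> complex) set" where
  "ell2 h = {u. (\<lambda>a. (cmod (u a))\<^sup>2) summable_on grid h}"

definition ell2_inner :: "real \<Rightarrow> (real \<Rightarrow> complex) \<Rightarrow> (real \<Rightarrow> complex) \<Rightarrow> complex" where
  "ell2_inner h u v = of_real h * (\<Sum>\<^sub>\<infinity>a\<in>grid h. u a * cnj (v a))"


function kravchuk_poly :: "real \<Rightarrow> int \<Rightarrow> real poly" where
  "kravchuk_poly h n =
     (if n < 0 then 0
      else if n = 0 then 1
      else [:0, 2:] * kravchuk_poly h (n - 1)
           - smult (2 * of_int (n - 1) * (1 - h\<^sup>2 * of_int (n - 2) / 2)) (kravchuk_poly h (n - 2)))"
  by auto
termination
  by (relation "measure (\<lambda>(h, n). nat (n + 1))") auto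

declare kravchuk_poly.simps [simp del]

lemma kravchuk_poly_neg: "n < 0 \<Longrightarrow> kravchuk_poly h n = 0"
  by (simp add: kravchuk_poly.simps)

lemma kravchuk_poly_0: "kravchuk_poly h 0 = 1"
  by (simp add: kravchuk_poly.simps)

lemma poly_kravchuk_poly_rec:
  assumes "n \<ge> 0"
  shows "poly (kravchuk_poly h (n + 1)) x =
           2 * x * poly (kravchuk_poly h n) x
           - 2 * of_int n * (1 - h\<^sup>2 * (of_int (n - 1) / 2)) * poly (kravchuk_poly h (n - 1)) x"
  using assms by (subst kravchuk_poly.simps) (simp add: algebra_simps)


definition kravchuk_alpha :: "nat \<Rightarrow> real \<Rightarrow> nat \<Rightarrow> real" where
  "kravchuk_alpha N h n = 1 / h ^ n * sqrt (fact (N - n) / (fact N * fact n))"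

text \<open>
  For \<open>h > 0\<close>, \<open>N = 2 / h\<^sup>2\<close> even and \<open>a \<in> A_set h\<close>, the number \<open>1 / h\<^sup>2 + a / h\<close> is an
  integer in \<open>{0..N}\<close>, so that \<open>nat \<lfloor>_\<rfloor>\<close> below is only a change of type.
\<close>

definition kravchuk_weight :: "nat \<Rightarrow> real \<Rightarrow> real \<Rightarrow> real" where
  "kravchuk_weight N h a =
     (if a \<in> A_set h
      then 1 / (h * 2 ^ N) * of_nat (N choose nat \<lfloor>1 / h\<^sup>2 + a / h\<rfloor>)
      else 0)"

text \<open>The value \<open>0\<close> outside \<open>0 \<le> n \<le> N\<close> is the convention for the indices \<open>-1\<close> and \<open>N + 1\<close>.\<close>

definition kravchuk_fun :: "nat \<Rightarrow> real \<Rightarrow> int \<Rightarrow> real \<Rightarrow> complex" where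
  "kravchuk_fun N h n a =
     (if 0 \<le> n \<and> n \<le> int N
      then of_real (kravchuk_alpha N h (nat n) * poly (kravchuk_poly h n) a
                    * sqrt (kravchuk_weight N h a))
      else 0)"


definition H_op :: "real \<Rightarrow> (real \<Rightarrow> complex) \<Rightarrow> real \<Rightarrow> complex" where
  "H_op h u a =
     (if a \<in> A_set h
      then - of_real (1 / h\<^sup>2 * sqrt ((1 + a * h + h\<^sup>2) * (1 - a * h))) * u (a + h)
           - of_real (1 / h\<^sup>2 * sqrt ((1 - a * h + h\<^sup>2) * (1 + a * h))) * u (a - h)
           + of_real (1 + 2 / h\<^sup>2) * u a
      else 0)"

definition L_op :: "int \<Rightarrow> real \<Rightarrow> (real \<Rightarrow> complex) \<Rightarrow> real \<Rightarrow> complex" where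
  "L_op n h u a =
     (if a \<in> A_set h
      then of_real (of_int n * h - 1 / h + a) * u a
           + of_real (1 / h * sqrt ((1 - a * h) * (1 + a * h + h\<^sup>2))) * u (a + h)
      else 0)"

definition R_op :: "int \<Rightarrow> real \<Rightarrow> (real \<Rightarrow> complex) \<Rightarrow> real \<Rightarrow> complex" where
  "R_op n h u a =
     (if a \<in> A_set h
      then of_real (of_int n * h - 1 / h + a) * u a
           + of_real (1 / h * sqrt ((1 + a * h) * (1 - a * h + h\<^sup>2))) * u (a - h)
      else 0)"

end

theory Submission
  imports Defs
begin

text \<open>
  Put \<open>a\<^sub>k = h k - 1 / h\<close> for \<open>0 \<le> k \<le> N\<close>; these nodes are exactly the points of \<open>A_set h\<close>,
  and since \<open>N h\<^sup>2 = 2\<close> we have \<open>1 + a\<^sub>k h = k h\<^sup>2\<close> and \<open>1 - a\<^sub>k h = (N - k) h\<^sup>2\<close>.  The argument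
  rests on the first-order difference relation (lemma \<open>kravchuk_forward_diff\<close>)
  \<open>(1 - x h) (k\<^sub>n(x + h) - k\<^sub>n(x)) = n h (2 - (n - 1) h\<^sup>2) k\<^bsub>n-1\<^esub>(x) - n h\<^sup>2 k\<^sub>n(x)\<close>,
  a polynomial identity in \<open>x\<close> and \<open>h\<close> that follows by induction from the three-term recurrence.
  The recurrence contains only \<open>h\<^sup>2\<close>, so replacing \<open>h\<close> by \<open>- h\<close> gives the companion relation for
  the backward difference.

  On \<open>A_set h\<close> the binomial weight satisfies
  \<open>(1 + a h + h\<^sup>2) \<rho>(a + h) = (1 - a h) \<rho>(a)\<close>.  Hence, when \<open>L_op\<close> and
  \<open>R_op\<close> are applied to \<open>k\<^sub>n \<surd>\<rho>\<close>, their square roots times \<open>\<surd>\<rho>(a \<plusminus> h)\<close> become \<open>1 - a h\<close> and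
  \<open>1 + a h\<close> times \<open>\<surd>\<rho>(a)\<close>, and the two difference relations turn into the ladder relations
  (\<open>L_op_kravchuk_fun\<close>, \<open>R_op_kravchuk_fun\<close>).  At the top index one also needs that
  \<open>k\<^bsub>N+1\<^esub>\<close> vanishes on all nodes, which the backward relation gives node by node
  from the left.

  On \<open>A_set h\<close> one has \<open>H = 1 + 2 n + 2 a / h - (L\<^sub>n + R\<^sub>n) / h\<close>, so the eigenvalue equation is
  the sum of the ladder relations combined with the recurrence.  The operators \<open>L\<^sub>n\<close> and \<open>R\<^sub>n\<close>
  are adjoint by a shift of the summation index (the boundary coefficients vanish), so \<open>H\<close> is
  symmetric and eigenfunctions with different indices are orthogonal.  The norms agree because
  \<open>\<langle>R\<^sub>n \<phi>\<^sub>n, \<phi>\<^bsub>n+1\<^esub>\<rangle> = \<langle>\<phi>\<^sub>n, L\<^sub>n \<phi>\<^bsub>n+1\<^esub>\<rangle>\<close>, where \<open>L\<^sub>n\<close> may be replaced by \<open>L\<^bsub>n+1\<^esub> = L\<^sub>n + h\<close> (on \<open>A_set h\<close>) by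
  orthogonality and the two ladder coefficients coincide; and \<open>\<phi>\<^sub>0\<close> has norm \<open>1\<close> by the
  binomial theorem.

  The identity for the compositions of the ladder operators is a comparison of the coefficients
  of \<open>u(a)\<close>, \<open>u(a + h)\<close> and \<open>u(a - h)\<close> (\<open>ladder_composition\<close>).
\<close>

section \<open>Difference relations for Kravchuk polynomials\<close>

lemma kravchuk_poly_uminus: "kravchuk_poly (- h) n = kravchuk_poly h n"
proof (induction h n rule: kravchuk_poly.induct)
  case (1 h n)
  show ?case
    by (subst (1 2) kravchuk_poly.simps) (use 1 in simp)
qed

lemma kravchuk_three_term:
  assumes "0 \<le> n"
  shows "poly (kravchuk_poly h (n + 1)) x = 2 * x * poly (kravchuk_poly h n) x
    - of_int n * (2 - (of_int n - 1) * h\<^sup>2) * poly (kravchuk_poly h (n - 1)) x"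
  using poly_kravchuk_poly_rec[OF assms, of h x] by (simp add: field_simps)

lemma kravchuk_forward_diff_nat:
  "(1 - x * h) * (poly (kravchuk_poly h (int n)) (x + h) - poly (kravchuk_poly h (int n)) x)
   = real n * h * (2 - (real n - 1) * h\<^sup>2) * poly (kravchuk_poly h (int n - 1)) x
     - real n * h\<^sup>2 * poly (kravchuk_poly h (int n)) x"
proof (induction n rule: induct_nat_012)
  case 0
  show ?case by (simp add: kravchuk_poly_0)
next
  case 1
  have "poly (kravchuk_poly h 1) y = 2 * y" for y
    using poly_kravchuk_poly_rec[of 0 h y] by (simp add: kravchuk_poly_0)
  then show ?case by (simp add: kravchuk_poly_0 algebra_simps power2_eq_square)
next
  case (ge2 n)
  define p0 p1 p2 p3 where "p0 = poly (kravchuk_poly h (int n - 1)) x"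
    and "p1 = poly (kravchuk_poly h (int n)) x"
    and "p2 = poly (kravchuk_poly h (int n + 1)) x"
    and "p3 = poly (kravchuk_poly h (int n + 2)) x"
  define q1 q2 q3 where "q1 = poly (kravchuk_poly h (int n)) (x + h)"
    and "q2 = poly (kravchuk_poly h (int n + 1)) (x + h)"
    and "q3 = poly (kravchuk_poly h (int n + 2)) (x + h)"
  note defs = p0_def p1_def p2_def p3_def q1_def q2_def q3_def
  let ?m = "real n"
  have p2: "p2 = 2 * x * p1 - ?m * (2 - (?m - 1) * h\<^sup>2) * p0"
    using kravchuk_three_term[of "int n" h x] by (simp add: defs)
  have p3: "p3 = 2 * x * p2 - (?m + 1) * (2 - ?m * h\<^sup>2) * p1"
    using kravchuk_three_term[of "int n + 1" h x] by (simp add: defs add.commute)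
  have q3: "q3 = 2 * (x + h) * q2 - (?m + 1) * (2 - ?m * h\<^sup>2) * q1"
    using kravchuk_three_term[of "int n + 1" h "x + h"] by (simp add: defs add.commute)
  have "(1 - x * h) * (q1 - p1) = ?m * h * (2 - (?m - 1) * h\<^sup>2) * p0 - ?m * h\<^sup>2 * p1"
    using ge2(1) by (simp add: defs)
  \<comment> \<open>eliminating \<open>p0\<close> through the recurrence keeps the remaining identity free of it\<close>
  also have "\<dots> = h * (2 * x * p1 - p2) - ?m * h\<^sup>2 * p1"
    unfolding p2 by (simp add: algebra_simps)
  finally have d1: "(1 - x * h) * (q1 - p1) = h * (2 * x * p1 - p2) - ?m * h\<^sup>2 * p1" .
  have d2: "(1 - x * h) * (q2 - p2) = (?m + 1) * h * (2 - ?m * h\<^sup>2) * p1 - (?m + 1) * h\<^sup>2 * p2"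
    using ge2(2) by (simp add: defs add.commute)
  have "(1 - x * h) * (q3 - p3)
      = 2 * (x + h) * ((1 - x * h) * (q2 - p2)) + 2 * h * (1 - x * h) * p2
        - (?m + 1) * (2 - ?m * h\<^sup>2) * ((1 - x * h) * (q1 - p1))"
    unfolding q3 p3 by (simp add: algebra_simps)
  also have "\<dots> = (?m + 2) * h * (2 - (?m + 1) * h\<^sup>2) * p2 - (?m + 2) * h\<^sup>2 * p3"
    unfolding d1 d2 p3 by (simp add: algebra_simps power2_eq_square)
  finally show ?case by (simp add: defs add.commute)
qed

lemma kravchuk_forward_diff:
  assumes "0 \<le> n"
  shows "(1 - x * h) * poly (kravchuk_poly h n) (x + h)
    = (1 - x * h - of_int n * h\<^sup>2) * poly (kravchuk_poly h n) x
      + of_int n * h * (2 - (of_int n - 1) * h\<^sup>2) * poly (kravchuk_poly h (n - 1)) x"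
  using kravchuk_forward_diff_nat[of x h "nat n"] assms by (simp add: algebra_simps)

text \<open>This is the forward relation for \<open>- h\<close>.\<close>

lemma kravchuk_backward_diff:
  assumes "0 \<le> n"
  shows "(1 + x * h) * poly (kravchuk_poly h n) (x - h)
    = (1 + x * h - of_int n * h\<^sup>2) * poly (kravchuk_poly h n) x
      - of_int n * h * (2 - (of_int n - 1) * h\<^sup>2) * poly (kravchuk_poly h (n - 1)) x"
  using kravchuk_forward_diff[OF assms, of x "- h"] by (simp add: kravchuk_poly_uminus)

section \<open>The grid nodes and the binomial weight\<close>

text \<open>The relation \<open>h = \<surd>2 N\<^sup>-\<^sup>1\<^sup>/\<^sup>2\<close> in polynomial form.  Evenness of \<open>N\<close> makes
  \<open>1 / h\<^sup>2 = N / 2\<close> an integer, so that the interval ends \<open>\<plusminus> 1 / h\<close> are grid points.\<close>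

locale kravchuk_grid =
  fixes N :: nat and h :: real
  assumes even_N: "even N" and h_pos: "h > 0" and N_h: "real N * h\<^sup>2 = 2"
begin

text \<open>The \<open>k\<close>-th point of \<open>A_set h\<close>, counted from the left end \<open>- 1 / h\<close>.\<close>

definition node :: "nat \<Rightarrow> real" where
  "node k = h * real k - 1 / h"

lemma node_Suc: "node (Suc k) = node k + h"
  by (simp add: node_def algebra_simps)

lemma node_mult: "node k * h = real k * h\<^sup>2 - 1"
  using h_pos by (simp add: node_def field_simps power2_eq_square)

lemma one_minus_node_mult: "1 - node k * h = (real N - real k) * h\<^sup>2"
  unfolding node_mult using N_h by (simp add: algebra_simps)

lemma inj_node: "inj node"
  using h_pos by (auto simp: node_def inj_def)

lemma A_set_eq: "A_set h = node ` {..N}"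
proof -
  define M where "M = N div 2"
  have N: "N = 2 * M" using even_N by (simp add: M_def)
  have "real M * h * h = 1" using N_h by (simp add: N power2_eq_square)
  then have M: "1 / h = h * real M" using h_pos by (simp add: field_simps)
  have node_eq: "node k = h * of_int (int k - int M)" for k
    by (simp add: node_def M algebra_simps)
  show ?thesis
  proof (intro set_eqI iffI)
    fix a assume "a \<in> A_set h"
    then obtain j :: int where j: "a = h * of_int j" and "- (1 / h) \<le> a" "a \<le> 1 / h"
      unfolding A_set_def grid_def by auto
    then have "h * - real M \<le> h * of_int j" "h * of_int j \<le> h * real M"
      unfolding M by simp_all
    then have "- real M \<le> of_int j" "of_int j \<le> real M"
      using h_pos by (simp_all only: mult_le_cancel_left_pos)
    then have "- int M \<le> j" "j \<le> int M" by linarith+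
    then have "nat (j + int M) \<le> N" "a = node (nat (j + int M))"
      unfolding node_eq j N by auto
    then show "a \<in> node ` {..N}" by blast
  next
    fix a assume "a \<in> node ` {..N}"
    then obtain k where k: "k \<le> N" "a = node k" by blast
    have "h * - real M \<le> a" "a \<le> h * real M"
      unfolding k(2) node_eq using k(1) h_pos
      by (simp_all only: mult_le_cancel_left_pos) (auto simp: N)
    moreover have "a \<in> grid h" unfolding k(2) node_eq grid_def by blast
    ultimately show "a \<in> A_set h" unfolding A_set_def using M by simp
  qed
qed

lemma A_set_subset_grid: "A_set h \<subseteq> grid h"
  by (simp add: A_set_def)

lemma node_in_A_set_iff: "node k \<in> A_set h \<longleftrightarrow> k \<le> N"
  unfolding A_set_eq using inj_node by (auto dest: injD)

lemma A_setE:
  assumes "a \<in> A_set h"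
  obtains k where "k \<le> N" "a = node k"
  using assms unfolding A_set_eq by blast

text \<open>For \<open>k > N\<close> both sides are \<open>0\<close>.\<close>

lemma weight_node: "kravchuk_weight N h (node k) = real (N choose k) / (h * 2 ^ N)"
proof -
  have "1 / h\<^sup>2 + node k / h = real k"
    using h_pos by (simp add: node_def field_simps power2_eq_square)
  then show ?thesis
    by (auto simp: kravchuk_weight_def node_in_A_set_iff binomial_eq_0)
qed

lemma weight_nonneg: "0 \<le> kravchuk_weight N h a"
  using h_pos by (simp add: kravchuk_weight_def)

lemma weight_step:
  assumes "a \<in> A_set h"
  shows "(1 + a * h + h\<^sup>2) * kravchuk_weight N h (a + h) = (1 - a * h) * kravchuk_weight N h a"
proof -
  obtain k where k: "k \<le> N" "a = node k" using A_setE[OF assms] .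
  have "real (Suc k) * real (N choose Suc k) = real (N - k) * real (N choose k)"
    unfolding of_nat_mult[symmetric] binomial_absorption binomial_absorb_comp by (rule refl)
  then have "(real k + 1) * real (N choose Suc k) = (real N - real k) * real (N choose k)"
    using k(1) by (simp add: of_nat_diff algebra_simps)
  then have "(real k + 1) * h\<^sup>2 * (real (N choose Suc k) / (h * 2 ^ N))
      = (real N - real k) * h\<^sup>2 * (real (N choose k) / (h * 2 ^ N))"
    by (metis (no_types, lifting) mult.commute mult.left_commute times_divide_eq_right)
  moreover have "1 + node k * h + h\<^sup>2 = (real k + 1) * h\<^sup>2"
    unfolding node_mult by (simp add: algebra_simps)
  ultimately show ?thesis
    unfolding k(2) node_Suc[symmetric] weight_node one_minus_node_mult by simp
qed

lemma A_set_bounds: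
  assumes "a \<in> A_set h"
  shows "0 \<le> 1 - a * h" "0 \<le> 1 + a * h"
proof -
  obtain k where k: "k \<le> N" "a = node k" using A_setE[OF assms] .
  show "0 \<le> 1 - a * h" using k by (simp add: one_minus_node_mult)
  show "0 \<le> 1 + a * h" using k by (simp add: node_mult)
qed

text \<open>The next two facts cover the boundary points: outside \<open>A_set h\<close> the neighbour is
  multiplied by a vanishing factor.\<close>

lemma right_neighbour:
  assumes "a \<in> A_set h"
  shows "a + h \<in> A_set h \<or> 1 - a * h = 0"
proof -
  obtain k where k: "k \<le> N" "a = node k" using A_setE[OF assms] .
  show ?thesis
    using k
    by (cases "k = N")
      (simp_all add: node_Suc[symmetric] node_in_A_set_iff one_minus_node_mult)
qed

lemma left_neighbour:
  assumes "a \<in> A_set h"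
  shows "a - h \<in> A_set h \<or> 1 + a * h = 0"
proof -
  obtain k where k: "k \<le> N" "a = node k" using A_setE[OF assms] .
  show ?thesis
    using k by (cases k) (auto simp: node_Suc node_in_A_set_iff node_mult)
qed

lemma sqrt_weight_right:
  assumes "a \<in> A_set h"
  shows "sqrt ((1 - a * h) * (1 + a * h + h\<^sup>2)) * sqrt (kravchuk_weight N h (a + h))
    = (1 - a * h) * sqrt (kravchuk_weight N h a)"
proof -
  have "(1 - a * h) * (1 + a * h + h\<^sup>2) * kravchuk_weight N h (a + h)
      = (1 - a * h)\<^sup>2 * kravchuk_weight N h a"
    using weight_step[OF assms] by (simp add: power2_eq_square mult.assoc)
  then show ?thesis
    using A_set_bounds(1)[OF assms]
    by (simp add: real_sqrt_mult[symmetric]) (simp add: real_sqrt_mult)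
qed

lemma sqrt_weight_left:
  assumes "a \<in> A_set h"
  shows "sqrt ((1 + a * h) * (1 - a * h + h\<^sup>2)) * sqrt (kravchuk_weight N h (a - h))
    = (1 + a * h) * sqrt (kravchuk_weight N h a)"
proof (cases "a - h \<in> A_set h")
  case True
  have "(1 + a * h) * kravchuk_weight N h a = (1 - a * h + h\<^sup>2) * kravchuk_weight N h (a - h)"
    using weight_step[OF True] by (simp add: algebra_simps power2_eq_square)
  then have "(1 + a * h) * (1 - a * h + h\<^sup>2) * kravchuk_weight N h (a - h)
      = (1 + a * h)\<^sup>2 * kravchuk_weight N h a"
    by (simp add: power2_eq_square mult.assoc)
  then show ?thesis
    using A_set_bounds(2)[OF assms]
    by (simp add: real_sqrt_mult[symmetric]) (simp add: real_sqrt_mult)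
next
  case False
  then have "1 + a * h = 0" using left_neighbour[OF assms] by blast
  then show ?thesis by simp
qed

section \<open>Ladder relations and eigenfunctions\<close>

lemma kravchuk_poly_top_node:
  assumes "k \<le> N"
  shows "poly (kravchuk_poly h (int N + 1)) (node k) = 0"
proof -
  \<comment> \<open>the second term of the backward relation carries the factor \<open>2 - N h\<^sup>2 = 0\<close>\<close>
  have step: "(1 + x * h) * poly (kravchuk_poly h (int N + 1)) (x - h)
      = - (1 - x * h + h\<^sup>2) * poly (kravchuk_poly h (int N + 1)) x" for x
  proof -
    have eq: "1 + x * h - (real N + 1) * h\<^sup>2 = - (1 - x * h + h\<^sup>2)"
      using N_h by (simp add: algebra_simps)
    show ?thesis
      using kravchuk_backward_diff[of "int N + 1" x h] N_h by (simp add: eq)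
  qed
  have nz: "- (1 - node i * h + h\<^sup>2) \<noteq> 0" if "i \<le> N" for i
  proof -
    have "0 \<le> 1 - node i * h" unfolding one_minus_node_mult using that by simp
    moreover have "h\<^sup>2 > 0" using h_pos by simp
    ultimately show ?thesis by linarith
  qed
  show ?thesis
    using assms
  proof (induction k)
    case 0
    have "- (1 - node 0 * h + h\<^sup>2) * poly (kravchuk_poly h (int N + 1)) (node 0) = 0"
      using step[of "node 0"] by (simp add: node_mult)
    then show ?case using nz[of 0] by (simp only: mult_eq_0_iff) simp
  next
    case (Suc k)
    have "- (1 - node (Suc k) * h + h\<^sup>2) * poly (kravchuk_poly h (int N + 1)) (node (Suc k)) = 0"
      using step[of "node (Suc k)"] Suc by (simp add: node_Suc)
    then show ?case using nz[OF Suc.prems] by (simp only: mult_eq_0_iff) simp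
  qed
qed

lemma kravchuk_fun_outside:
  "a \<notin> A_set h \<Longrightarrow> kravchuk_fun N h n a = 0"
  by (simp add: kravchuk_fun_def kravchuk_weight_def)

lemma ladder_coeff_eq:
  "(real n + 1) * (2 - real n * h\<^sup>2) = h\<^sup>2 * ((real n + 1) * (real N - real n))"
  unfolding N_h[symmetric] by (simp add: algebra_simps)

lemma ladder_coeff_nonneg: "n \<le> N \<Longrightarrow> 0 \<le> (real n + 1) * (2 - real n * h\<^sup>2)"
  unfolding ladder_coeff_eq by simp

text \<open>Normalised by \<open>\<alpha>\<^sub>n\<close>, the raising and the lowering relation acquire the same
  coefficient between the indices \<open>n\<close> and \<open>n + 1\<close>.\<close>

lemma alpha_Suc:
  assumes "n < N"
  shows "kravchuk_alpha N h n
    = sqrt ((real n + 1) * (2 - real n * h\<^sup>2)) * kravchuk_alpha N h (Suc n)"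
proof -
  have f: "(fact (N - n) :: real) = (real N - real n) * fact (N - Suc n)"
    using assms by (metis Suc_diff_Suc fact_Suc of_nat_diff less_imp_le_nat)
  have "fact (N - n) / (fact N * fact n)
      = (real n + 1) * (real N - real n) * (fact (N - Suc n) / (fact N * fact (Suc n)))"
    unfolding f fact_Suc of_nat_mult by (simp add: divide_simps)
  then show ?thesis
    unfolding ladder_coeff_eq using h_pos by (simp add: kravchuk_alpha_def real_sqrt_mult real_sqrt_divide)
qed

text \<open>The left-hand sides of the next two lemmas are \<open>L_op n h f a\<close> and \<open>R_op n h f a\<close>, written
  over the reals, for the unnormalized function \<open>f = k\<^sub>n \<surd>\<rho>\<close>.\<close>

lemma lowering_unnormalized:
  assumes "a \<in> A_set h" "0 \<le> n"
  defines "f \<equiv> \<lambda>x. poly (kravchuk_poly h n) x * sqrt (kravchuk_weight N h x)"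
  shows "(of_int n * h - 1 / h + a) * f a
      + 1 / h * sqrt ((1 - a * h) * (1 + a * h + h\<^sup>2)) * f (a + h)
    = of_int n * (2 - (of_int n - 1) * h\<^sup>2) * poly (kravchuk_poly h (n - 1)) a
      * sqrt (kravchuk_weight N h a)" (is "?lhs = ?rhs")
proof -
  let ?p = "\<lambda>x. poly (kravchuk_poly h n) x" and ?w = "sqrt (kravchuk_weight N h a)"
  have "?lhs = (of_int n * h - 1 / h + a) * ?p a * ?w
      + 1 / h * ?p (a + h)
        * (sqrt ((1 - a * h) * (1 + a * h + h\<^sup>2)) * sqrt (kravchuk_weight N h (a + h)))"
    by (simp add: f_def)
  also have "\<dots> = ((of_int n * h - 1 / h + a) * ?p a + 1 / h * ((1 - a * h) * ?p (a + h))) * ?w"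
    unfolding sqrt_weight_right[OF assms(1)] by (simp add: algebra_simps)
  also have "\<dots> = ?rhs"
    unfolding kravchuk_forward_diff[OF assms(2)] using h_pos
    by (simp add: field_simps power2_eq_square)
  finally show ?thesis .
qed

lemma raising_unnormalized:
  assumes "a \<in> A_set h" "0 \<le> n"
  defines "f \<equiv> \<lambda>x. poly (kravchuk_poly h n) x * sqrt (kravchuk_weight N h x)"
  shows "(of_int n * h - 1 / h + a) * f a
      + 1 / h * sqrt ((1 + a * h) * (1 - a * h + h\<^sup>2)) * f (a - h)
    = poly (kravchuk_poly h (n + 1)) a * sqrt (kravchuk_weight N h a)" (is "?lhs = ?rhs")
proof -
  let ?p = "\<lambda>x. poly (kravchuk_poly h n) x" and ?w = "sqrt (kravchuk_weight N h a)"
  have "?lhs = (of_int n * h - 1 / h + a) * ?p a * ?w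
      + 1 / h * ?p (a - h)
        * (sqrt ((1 + a * h) * (1 - a * h + h\<^sup>2)) * sqrt (kravchuk_weight N h (a - h)))"
    by (simp add: f_def)
  also have "\<dots> = ((of_int n * h - 1 / h + a) * ?p a + 1 / h * ((1 + a * h) * ?p (a - h))) * ?w"
    unfolding sqrt_weight_left[OF assms(1)] by (simp add: algebra_simps)
  also have "\<dots> = ?rhs"
    unfolding kravchuk_backward_diff[OF assms(2)] kravchuk_three_term[OF assms(2)] using h_pos
    by (simp add: field_simps power2_eq_square)
  finally show ?thesis .
qed

lemma L_op_kravchuk_fun:
  assumes "0 \<le> n" "n \<le> int N"
  shows "L_op n h (kravchuk_fun N h n) a
    = of_real (sqrt (of_int n * (2 - of_int n * h\<^sup>2 + h\<^sup>2))) * kravchuk_fun N h (n - 1) a"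
proof (cases "a \<in> A_set h")
  case True
  let ?w = "sqrt (kravchuk_weight N h a)"
  have "L_op n h (kravchuk_fun N h n) a = of_real (kravchuk_alpha N h (nat n)
      * (of_int n * (2 - (of_int n - 1) * h\<^sup>2) * poly (kravchuk_poly h (n - 1)) a * ?w))"
    unfolding lowering_unnormalized[OF True assms(1), symmetric]
    using True assms by (simp add: L_op_def kravchuk_fun_def algebra_simps)
  also have "\<dots> = of_real (sqrt (of_int n * (2 - of_int n * h\<^sup>2 + h\<^sup>2))) * kravchuk_fun N h (n - 1) a"
  proof (cases "n = 0")
    case False
    define k where "k = nat n - 1"
    have k: "n = int k + 1" "k < N" "nat n = Suc k" using False assms by (auto simp: k_def)
    define q where "q = (real k + 1) * (2 - real k * h\<^sup>2)"
    have "sqrt q * sqrt q = q"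
      using ladder_coeff_nonneg[of k] k(2) unfolding q_def by simp
    then have "kravchuk_alpha N h (Suc k) * q = sqrt q * kravchuk_alpha N h k"
      using alpha_Suc[OF k(2)] unfolding q_def[symmetric]
      by (simp add: mult.commute mult.left_commute)
    then have "kravchuk_alpha N h (Suc k) * (q * (poly (kravchuk_poly h (int k)) a * ?w))
        = sqrt q * (kravchuk_alpha N h k * poly (kravchuk_poly h (int k)) a * ?w)"
      by (simp only: mult.assoc[symmetric])
    moreover have "of_int n * (2 - of_int n * h\<^sup>2 + h\<^sup>2) = q"
      "of_int n * (2 - (of_int n - 1) * h\<^sup>2) = q"
      unfolding q_def k(1) by (simp_all add: algebra_simps)
    moreover have "nat (1 + int k) = Suc k" by simp
    ultimately show ?thesis
      unfolding kravchuk_fun_def using k(1,2)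
      by (simp flip: of_real_mult add: mult.assoc add.commute)
  qed simp
  finally show ?thesis .
next
  case False
  then show ?thesis by (simp add: L_op_def kravchuk_fun_outside)
qed

lemma R_op_kravchuk_fun:
  assumes "0 \<le> n" "n \<le> int N"
  shows "R_op n h (kravchuk_fun N h n) a
    = of_real (sqrt ((2 - of_int n * h\<^sup>2) * (of_int n + 1))) * kravchuk_fun N h (n + 1) a"
proof (cases "a \<in> A_set h")
  case True
  let ?w = "sqrt (kravchuk_weight N h a)"
  have "R_op n h (kravchuk_fun N h n) a
      = of_real (kravchuk_alpha N h (nat n) * (poly (kravchuk_poly h (n + 1)) a * ?w))"
    unfolding raising_unnormalized[OF True assms(1), symmetric]
    using True assms by (simp add: R_op_def kravchuk_fun_def algebra_simps)
  also have "\<dots> = of_real (sqrt ((2 - of_int n * h\<^sup>2) * (of_int n + 1))) * kravchuk_fun N h (n + 1) a"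
  proof (cases "n = int N")
    case False
    define k where "k = nat n"
    have k: "n = int k" "k < N" "nat (n + 1) = Suc k" using False assms by (auto simp: k_def)
    show ?thesis
      using k alpha_Suc[OF k(2)]
      by (simp add: kravchuk_fun_def mult.assoc mult.commute[of _ "1 + real k"] add.commute)
  next
    case n: True
    obtain k where "k \<le> N" "a = node k" using A_setE[OF True] .
    then have "poly (kravchuk_poly h (n + 1)) a = 0"
      using kravchuk_poly_top_node n by simp
    then show ?thesis using n by (simp add: kravchuk_fun_def)
  qed
  finally show ?thesis .
next
  case False
  then show ?thesis by (simp add: R_op_def kravchuk_fun_outside)
qed

text \<open>The right-hand side does not depend on \<open>n\<close>: the index is chosen to suit each use.\<close>

lemma H_op_eq_ladder:
  assumes "a \<in> A_set h"
  shows "H_op h u a = of_real (1 + 2 * of_int n + 2 * a / h) * u a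
    - of_real (1 / h) * (L_op n h u a + R_op n h u a)"
proof -
  define s t where "s = sqrt ((1 - a * h) * (1 + a * h + h\<^sup>2))"
    and "t = sqrt ((1 + a * h) * (1 - a * h + h\<^sup>2))"
  have "H_op h u a = - of_real (s / h\<^sup>2) * u (a + h) - of_real (t / h\<^sup>2) * u (a - h)
      + of_real (1 + 2 / h\<^sup>2) * u a"
    using assms unfolding s_def t_def H_op_def
    by (simp add: mult.commute[of "1 + a * h + h\<^sup>2"] mult.commute[of "1 - a * h + h\<^sup>2"])
  also have "\<dots> = of_real (1 + 2 * of_int n + 2 * a / h
        - 1 / h * (2 * (of_int n * h - 1 / h + a))) * u a
      - of_real (1 / h * (1 / h * s)) * u (a + h) - of_real (1 / h * (1 / h * t)) * u (a - h)"
    using h_pos by (simp add: power2_eq_square field_simps)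
  also have "\<dots> = of_real (1 + 2 * of_int n + 2 * a / h) * u a
      - of_real (1 / h) * (L_op n h u a + R_op n h u a)"
  proof -
    have LR: "L_op n h u a = of_real (of_int n * h - 1 / h + a) * u a + of_real (1 / h * s) * u (a + h)"
      "R_op n h u a = of_real (of_int n * h - 1 / h + a) * u a + of_real (1 / h * t) * u (a - h)"
      using assms by (simp_all add: L_op_def R_op_def s_def t_def)
    show ?thesis unfolding LR by (simp add: algebra_simps)
  qed
  finally show ?thesis .
qed

lemma H_op_kravchuk_fun:
  assumes "0 \<le> n" "n \<le> int N"
  shows "H_op h (kravchuk_fun N h n) a = of_int (2 * n + 1) * kravchuk_fun N h n a"
proof (cases "a \<in> A_set h")
  case True
  let ?w = "sqrt (kravchuk_weight N h a)" and ?al = "kravchuk_alpha N h (nat n)"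
  have "L_op n h (kravchuk_fun N h n) a + R_op n h (kravchuk_fun N h n) a
      = of_real (?al * (of_int n * (2 - (of_int n - 1) * h\<^sup>2) * poly (kravchuk_poly h (n - 1)) a * ?w
        + poly (kravchuk_poly h (n + 1)) a * ?w))"
    unfolding lowering_unnormalized[OF True assms(1), symmetric]
      raising_unnormalized[OF True assms(1), symmetric]
    using True assms by (simp add: L_op_def R_op_def kravchuk_fun_def algebra_simps)
  also have "\<dots> = of_real (2 * a) * kravchuk_fun N h n a"
    unfolding kravchuk_three_term[OF assms(1)]
    using assms by (simp add: kravchuk_fun_def algebra_simps)
  finally show ?thesis
    unfolding H_op_eq_ladder[OF True, of _ n] by (simp add: algebra_simps)
next
  case False
  then show ?thesis by (simp add: H_op_def kravchuk_fun_outside)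
qed

section \<open>Adjointness and orthonormality\<close>

lemma ell2_inner_eq_sum:
  assumes "\<And>a. a \<notin> A_set h \<Longrightarrow> u a = 0 \<or> v a = 0"
  shows "ell2_inner h u v = of_real h * (\<Sum>k\<le>N. u (node k) * cnj (v (node k)))"
proof -
  have "(\<Sum>\<^sub>\<infinity>a\<in>grid h. u a * cnj (v a)) = (\<Sum>\<^sub>\<infinity>a\<in>A_set h. u a * cnj (v a))"
    using assms A_set_subset_grid by (intro infsum_cong_neutral) auto
  also have "\<dots> = (\<Sum>a\<in>A_set h. u a * cnj (v a))"
    by (simp add: A_set_eq)
  also have "\<dots> = (\<Sum>k\<le>N. u (node k) * cnj (v (node k)))"
    unfolding A_set_eq using inj_node by (simp add: sum.reindex inj_on_subset)
  finally show ?thesis by (simp add: ell2_inner_def)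
qed

lemma L_op_outside: "a \<notin> A_set h \<Longrightarrow> L_op n h u a = 0"
  and R_op_outside: "a \<notin> A_set h \<Longrightarrow> R_op n h u a = 0"
  and H_op_outside: "a \<notin> A_set h \<Longrightarrow> H_op h u a = 0"
  by (simp_all add: L_op_def R_op_def H_op_def)

text \<open>No summability is needed: one factor of each product vanishes off the finite set
  \<open>A_set h\<close>.\<close>

lemma inner_R_op: "ell2_inner h (R_op n h u) v = ell2_inner h u (L_op n h v)"
proof -
  define s where "s k = 1 / h * sqrt ((1 - node k * h) * (1 + node k * h + h\<^sup>2))" for k
  have t: "1 / h * sqrt ((1 + node (Suc k) * h) * (1 - node (Suc k) * h + h\<^sup>2)) = s k" for k
    by (simp add: s_def node_Suc algebra_simps power2_eq_square)
  let ?t = "\<lambda>k. complex_of_real (1 / h * sqrt ((1 + node k * h) * (1 - node k * h + h\<^sup>2)))"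
  \<comment> \<open>the term at \<open>k = 0\<close> on the left and at \<open>k = N\<close> on the right has coefficient \<open>0\<close>,
    so both sums have \<open>N\<close> terms that match after a shift\<close>
  have "(\<Sum>k\<le>N. ?t k * u (node k - h) * cnj (v (node k)))
      = (\<Sum>k<N. of_real (s k) * u (node k) * cnj (v (node (Suc k))))"
    unfolding sum.atMost_shift t by (simp add: node_mult node_Suc)
  also have "\<dots> = (\<Sum>k\<le>N. of_real (s k) * u (node k) * cnj (v (node k + h)))"
  proof -
    have "s N = 0" by (simp add: s_def one_minus_node_mult)
    then show ?thesis by (simp add: lessThan_Suc_atMost[symmetric] node_Suc)
  qed
  finally have shift: "(\<Sum>k\<le>N. ?t k * u (node k - h) * cnj (v (node k)))
      = (\<Sum>k\<le>N. of_real (s k) * u (node k) * cnj (v (node k + h)))" .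
  have "(\<Sum>k\<le>N. R_op n h u (node k) * cnj (v (node k)))
      = (\<Sum>k\<le>N. of_real (of_int n * h - 1 / h + node k) * u (node k) * cnj (v (node k)))
        + (\<Sum>k\<le>N. ?t k * u (node k - h) * cnj (v (node k)))"
    unfolding sum.distrib[symmetric]
    by (intro sum.cong refl) (simp add: R_op_def node_in_A_set_iff algebra_simps)
  also have "\<dots> = (\<Sum>k\<le>N. u (node k) * cnj (L_op n h v (node k)))"
    unfolding shift sum.distrib[symmetric]
    by (intro sum.cong refl) (simp add: L_op_def node_in_A_set_iff s_def algebra_simps)
  finally show ?thesis
    by (simp add: ell2_inner_eq_sum L_op_outside R_op_outside)
qed

lemma inner_H_op: "ell2_inner h (H_op h u) v = ell2_inner h u (H_op h v)"
proof -
  define S where "S f g = (\<Sum>k\<le>N. f (node k) * cnj (g (node k)))" for f g :: "real \<Rightarrow> complex"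
  have RL: "S (R_op 0 h f) g = S f (L_op 0 h g)" for f g
    using inner_R_op[of 0 f g] h_pos
    by (simp add: ell2_inner_eq_sum L_op_outside R_op_outside S_def)
  have S_cnj: "S f g = cnj (S g f)" for f g
    by (simp add: S_def mult.commute)
  have LR: "S (L_op 0 h f) g = S f (R_op 0 h g)" for f g
    using RL[of g f] S_cnj by metis
  define D where "D = (\<Sum>k\<le>N. of_real (1 + 2 * node k / h) * (u (node k) * cnj (v (node k))))"
  have "S (H_op h u) v = D - of_real (1 / h) * (S (L_op 0 h u) v + S (R_op 0 h u) v)"
    unfolding S_def D_def sum.distrib[symmetric] sum_distrib_left sum_subtractf[symmetric]
    by (intro sum.cong refl)
       (simp add: H_op_eq_ladder[of _ _ 0] node_in_A_set_iff algebra_simps)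
  also have "\<dots> = D - of_real (1 / h) * (S u (L_op 0 h v) + S u (R_op 0 h v))"
    unfolding RL LR by (simp add: add.commute)
  also have "\<dots> = S u (H_op h v)"
    unfolding S_def D_def sum.distrib[symmetric] sum_distrib_left sum_subtractf[symmetric]
    by (intro sum.cong refl)
       (simp add: H_op_eq_ladder[of _ _ 0] node_in_A_set_iff algebra_simps)
  finally show ?thesis
    by (simp add: ell2_inner_eq_sum H_op_outside S_def)
qed

lemma ell2_inner_scale_left: "ell2_inner h (\<lambda>a. c * u a) v = c * ell2_inner h u v"
  and ell2_inner_scale_right: "ell2_inner h u (\<lambda>a. c * v a) = cnj c * ell2_inner h u v"
  by (simp_all add: ell2_inner_def mult.assoc mult.left_commute infsum_cmult_right')

lemma kravchuk_fun_orthogonal: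
  assumes "0 \<le> n" "n \<le> int N" "0 \<le> m" "m \<le> int N" "n \<noteq> m"
  shows "ell2_inner h (kravchuk_fun N h n) (kravchuk_fun N h m) = 0"
proof -
  have H: "H_op h (kravchuk_fun N h i) = (\<lambda>a. of_int (2 * i + 1) * kravchuk_fun N h i a)"
    if "0 \<le> i" "i \<le> int N" for i
    using H_op_kravchuk_fun[OF that] by blast
  have "of_int (2 * n + 1) * ell2_inner h (kravchuk_fun N h n) (kravchuk_fun N h m)
      = of_int (2 * m + 1) * ell2_inner h (kravchuk_fun N h n) (kravchuk_fun N h m)"
    using inner_H_op[of "kravchuk_fun N h n" "kravchuk_fun N h m"]
    unfolding H[OF assms(1,2)] H[OF assms(3,4)] ell2_inner_scale_left ell2_inner_scale_right by simp
  then have "of_int (2 * n + 1) = (of_int (2 * m + 1) :: complex)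
      \<or> ell2_inner h (kravchuk_fun N h n) (kravchuk_fun N h m) = 0"
    unfolding mult_cancel_right by blast
  then show ?thesis using assms(5) by (simp only: of_int_eq_iff) simp
qed

lemma kravchuk_fun_normalized:
  assumes "n \<le> N"
  shows "ell2_inner h (kravchuk_fun N h (int n)) (kravchuk_fun N h (int n)) = 1"
  using assms
proof (induction n)
  case 0
  have "kravchuk_fun N h 0 (node k) * cnj (kravchuk_fun N h 0 (node k))
      = of_real (real (N choose k) / (h * 2 ^ N))" for k
  proof -
    have "kravchuk_fun N h 0 (node k) = of_real (sqrt (kravchuk_weight N h (node k)))"
      by (simp add: kravchuk_fun_def kravchuk_alpha_def kravchuk_poly_0)
    then show ?thesis
      using weight_nonneg[of "node k"] by (simp add: weight_node[symmetric] flip: of_real_mult)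
  qed
  then have "ell2_inner h (kravchuk_fun N h 0) (kravchuk_fun N h 0)
      = of_real (h * (\<Sum>k\<le>N. real (N choose k) / (h * 2 ^ N)))"
    by (simp add: ell2_inner_eq_sum kravchuk_fun_outside)
  also have "(\<Sum>k\<le>N. real (N choose k) / (h * 2 ^ N)) = 2 ^ N / (h * 2 ^ N)"
    unfolding sum_divide_distrib[symmetric] of_nat_sum[symmetric] choose_row_sum by simp
  finally show ?case using h_pos by simp
next
  case (Suc n)
  let ?f = "kravchuk_fun N h (int n)" and ?g = "kravchuk_fun N h (int n + 1)"
  define q where "q = (2 - real n * h\<^sup>2) * (real n + 1)"
  have "q = h\<^sup>2 * ((real n + 1) * (real N - real n))"
    unfolding q_def ladder_coeff_eq[symmetric] by (rule mult.commute)
  then have "q > 0" using Suc.prems h_pos by simp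
  have R: "R_op (int n) h ?f = (\<lambda>a. of_real (sqrt q) * ?g a)"
    using R_op_kravchuk_fun[of "int n"] Suc.prems by (auto simp: q_def)
  have L: "L_op (int n) h ?g = (\<lambda>a. of_real (sqrt q) * ?f a - of_real h * ?g a)"
  proof
    fix a
    have "L_op (int n) h ?g a = L_op (int n + 1) h ?g a - of_real h * ?g a"
      by (simp add: L_op_def kravchuk_fun_outside algebra_simps)
    moreover have "(real n + 1) * (2 - (real n + 1) * h\<^sup>2 + h\<^sup>2) = q"
      by (simp add: q_def algebra_simps)
    ultimately show "L_op (int n) h ?g a = of_real (sqrt q) * ?f a - of_real h * ?g a"
      using L_op_kravchuk_fun[of "int n + 1" a] Suc.prems by simp
  qed
  have "ell2_inner h ?f (L_op (int n) h ?g)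
      = of_real (sqrt q) * ell2_inner h ?f ?f - of_real h * ell2_inner h ?f ?g"
    unfolding L
    by (simp add: ell2_inner_eq_sum kravchuk_fun_outside sum_subtractf sum_distrib_left
        algebra_simps)
  moreover have "ell2_inner h ?f ?g = 0"
    using Suc.prems by (intro kravchuk_fun_orthogonal) auto
  ultimately have "of_real (sqrt q) * ell2_inner h ?g ?g = of_real (sqrt q) * ell2_inner h ?f ?f"
    using inner_R_op[of "int n" ?f ?g] unfolding R ell2_inner_scale_left by simp
  then show ?case using \<open>q > 0\<close> Suc by (simp add: add.commute)
qed

section \<open>The second-order identity for the ladder operators\<close>

lemma ladder_composition:
  assumes a: "a \<in> A_set h"
  shows "1 / 2 * (R_op (n - 1) h (L_op n h u) a + L_op (n + 1) h (R_op n h u) a)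
    = of_real (1 - a * h - of_int n * h\<^sup>2) * H_op h u a
      + of_real ((2 * of_int n + 1) * a * h + (of_int n + 1) * of_int n * h\<^sup>2) * u a"
proof -
  define s t where "s = 1 / h * sqrt ((1 - a * h) * (1 + a * h + h\<^sup>2))"
    and "t = 1 / h * sqrt ((1 + a * h) * (1 - a * h + h\<^sup>2))"
  define x where "x = of_int n * h - 1 / h + a"
  have s_sq: "s\<^sup>2 = (1 - a * h) * (1 + a * h + h\<^sup>2) / h\<^sup>2"
    and t_sq: "t\<^sup>2 = (1 + a * h) * (1 - a * h + h\<^sup>2) / h\<^sup>2"
    using A_set_bounds[OF a] by (simp_all add: s_def t_def power_mult_distrib power_divide)
  \<comment> \<open>a neighbour of \<open>a\<close> outside \<open>A_set h\<close> has coefficient \<open>0\<close>, so no case distinction remains\<close>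
  have L: "of_real t * L_op n h u (a - h)
      = of_real t * (of_real (x - h) * u (a - h) + of_real t * u a)"
  proof (cases "a - h \<in> A_set h")
    case True
    have "1 / h * sqrt ((1 - (a - h) * h) * (1 + (a - h) * h + h\<^sup>2)) = t"
      by (simp add: t_def algebra_simps power2_eq_square)
    then show ?thesis using True by (simp add: L_op_def x_def algebra_simps)
  next
    case False
    then have "t = 0" using left_neighbour[OF a] by (auto simp: t_def)
    then show ?thesis by simp
  qed
  have R: "of_real s * R_op n h u (a + h)
      = of_real s * (of_real (x + h) * u (a + h) + of_real s * u a)"
  proof (cases "a + h \<in> A_set h")
    case True
    have "1 / h * sqrt ((1 + (a + h) * h) * (1 - (a + h) * h + h\<^sup>2)) = s"
      by (simp add: s_def algebra_simps power2_eq_square)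
    then show ?thesis using True by (simp add: R_op_def x_def algebra_simps)
  next
    case False
    then have "s = 0" using right_neighbour[OF a] by (auto simp: s_def)
    then show ?thesis by simp
  qed
  have RL: "R_op (n - 1) h (L_op n h u) a = of_real (x - h) * (of_real x * u a + of_real s * u (a + h))
      + of_real t * (of_real (x - h) * u (a - h) + of_real t * u a)"
    unfolding L[symmetric] using a by (simp add: R_op_def L_op_def s_def t_def x_def algebra_simps)
  have LR: "L_op (n + 1) h (R_op n h u) a
      = of_real (x + h) * (of_real x * u a + of_real t * u (a - h))
      + of_real s * (of_real (x + h) * u (a + h) + of_real s * u a)"
    unfolding R[symmetric] using a by (simp add: R_op_def L_op_def s_def t_def x_def algebra_simps)
  have comp: "1 / 2 * (R_op (n - 1) h (L_op n h u) a + L_op (n + 1) h (R_op n h u) a)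
      = of_real (x\<^sup>2 + (s\<^sup>2 + t\<^sup>2) / 2) * u a
        + of_real (x * s) * u (a + h) + of_real (x * t) * u (a - h)"
    unfolding RL LR by (simp add: field_simps power2_eq_square)
  have H: "H_op h u a = of_real (1 + 2 / h\<^sup>2) * u a - of_real (s / h) * u (a + h)
      - of_real (t / h) * u (a - h)"
    using a unfolding s_def t_def H_op_def
    by (simp add: mult.commute[of "1 + a * h + h\<^sup>2"] mult.commute[of "1 - a * h + h\<^sup>2"])
      (simp add: power2_eq_square)
  have xh: "1 - a * h - of_int n * h\<^sup>2 = - (x * h)"
    using h_pos by (simp add: x_def field_simps power2_eq_square)
  have diag: "x\<^sup>2 + (s\<^sup>2 + t\<^sup>2) / 2 = - (x * h) * (1 + 2 / h\<^sup>2)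
      + ((2 * of_int n + 1) * a * h + (of_int n + 1) * of_int n * h\<^sup>2)"
    unfolding s_sq t_sq x_def using h_pos by (simp add: field_simps power2_eq_square)
  show ?thesis
    unfolding comp H xh diag using h_pos by (simp add: field_simps)
qed

end

theorem theorem1:
  fixes N :: nat and h :: real and n m :: int
  assumes "N \<ge> 1" and "even N"
    and "h = sqrt 2 * real N powr (- 1 / 2)"
    and "0 \<le> n" and "n \<le> int N" and "0 \<le> m" and "m \<le> int N"
  shows "(\<forall>a\<in>grid h. H_op h (kravchuk_fun N h n) a = of_int (2 * n + 1) * kravchuk_fun N h n a)
    \<and> ell2_inner h (kravchuk_fun N h n) (kravchuk_fun N h m) = (if n = m then 1 else 0)
    \<and> (\<forall>a\<in>grid h. L_op n h (kravchuk_fun N h n) a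
          = of_real (sqrt (of_int n * (2 - of_int n * h\<^sup>2 + h\<^sup>2))) * kravchuk_fun N h (n - 1) a)
    \<and> (\<forall>a\<in>grid h. R_op n h (kravchuk_fun N h n) a
          = of_real (sqrt ((2 - of_int n * h\<^sup>2) * (of_int n + 1))) * kravchuk_fun N h (n + 1) a)
    \<and> (\<forall>u\<in>ell2 h. \<forall>v\<in>ell2 h. ell2_inner h (R_op n h u) v = ell2_inner h u (L_op n h v))
    \<and> (\<forall>u\<in>ell2 h. \<forall>a\<in>A_set h.
          1 / 2 * (R_op (n - 1) h (L_op n h u) a + L_op (n + 1) h (R_op n h u) a)
          = of_real (1 - a * h - of_int n * h\<^sup>2) * H_op h u a
            + of_real ((2 * of_int n + 1) * a * h + (of_int n + 1) * of_int n * h\<^sup>2) * u a)"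
proof -
  have "real N powr (- 1 / 2) = 1 / sqrt (real N)"
    by (simp add: powr_minus powr_half_sqrt field_simps)
  then have "h > 0" "real N * h\<^sup>2 = 2"
    using assms(1,3) by (simp_all add: power_mult_distrib power_divide)
  then interpret kravchuk_grid N h
    using assms(2) by unfold_locales
  have "ell2_inner h (kravchuk_fun N h n) (kravchuk_fun N h m) = (if n = m then 1 else 0)"
    using kravchuk_fun_orthogonal[of n m] kravchuk_fun_normalized[of "nat n"] assms(4-7) by auto
  then show ?thesis
    using assms(4,5) H_op_kravchuk_fun L_op_kravchuk_fun R_op_kravchuk_fun inner_R_op
      ladder_composition by simp
qed

end
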